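(* For every (possibly partial) function $f\colon X\to\{0,1\}$ with $X\subseteq\{0,1\}^m$, every success parameter $\gamma$ with $\frac12\le\gamma\le1$, and every $n\ge1$, \[ \overline{\overline{\mathrm{sR}}}_{\gamma^n}(f^n)=\Omega\big(n\cdot\overline{\overline{\mathrm{sR}}}_\gamma(f)\big), \] with a universal implied constant.
   Context: A deterministic decision tree queries input bits adaptively; a leaf $\ell$ is identified with the set of inputs reaching it, $\mathrm{cost}(\ell)$ is its depth, $D(x)$ is the leaf reached by $x$. A randomized algorithm $R$ is a probability distribution over deterministic decision trees. $f^n\colon X^n\to\{0,1\}^n$ is $f^n(x^{(1)},\dots,x^{(n)})=(f(x^{(1)}),\dots,f(x^{(n)}))$. For a function $g\colon Y\to\mathcal{O}$ (here $g=f$ with $\mathcal{O}=\{0,1\}$, or $g=f^n$ with $\mathcal O=\{0,1\}^n$) and a distribution $\nu$ on $Y$, the success score of a leaf is $\mathrm{success}^\nu_g(\ell)=\max_{y\in\mathcal O}\nu(\ell\cap g^{-1}(y))/\nu(\ell)$ (the success probability at that leaf with an optimal label), and $\overline{\mathrm{success}}^\nu_g(R)=\mathbb{E}_{D\sim R,x\sim\nu}[\mathrm{success}^\nu_g(D(x))]$. The success-conditioned (score-weighted) cost is $\overline{\mathrm{scost}}^\nu_g(R)=\mathbb{E}_{D\sim R,x\sim\nu}[\mathrm{success}^\nu_g(D(x))\,\mathrm{cost}(D(x))]/\overline{\mathrm{success}}^\nu_g(R)$, i.e., the expected cost conditioned on the (optimally labelled) algorithm being correct. Define $\overline{\overline{\mathrm{sR}}}_\gamma(g)=\max_\nu\min\{\overline{\mathrm{scost}}^\nu_g(R):\overline{\mathrm{success}}^\nu_g(R)\ge\gamma\}$,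 the maximum over distributions $\nu$ on $Y$. *)

theory Defs
  imports "HOL-Probability.Probability"
begin

text \<open>Inputs are bit strings indexed by a finite set \<open>Q\<close> of positions, i.e. elements of
  \<open>Q \<rightarrow>\<^sub>E UNIV\<close>. A single instance uses \<open>Q = {..<m}\<close>; an \<open>n\<close>-tuple of instances uses
  \<open>Q = {..<n} \<times> {..<m}\<close>, where position \<open>(j, i)\<close> is bit \<open>i\<close> of the \<open>j\<close>-th instance.\<close>

datatype 'q dtree = Leaf | Query 'q "'q dtree" "'q dtree"

abbreviation dtrees :: "'q set \<Rightarrow> 'q dtree set" where
  "dtrees Q \<equiv> {D. set_dtree D \<subseteq> Q}"

text \<open>A leaf is addressed by the sequence of answers leading to it; its depth is the length of
  that address.\<close>

fun leaf :: "'q dtree \<Rightarrow> ('q \<Rightarrow> bool) \<Rightarrow> bool list" where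
  "leaf Leaf x = []"
| "leaf (Query q D\<^sub>0 D\<^sub>1) x = x q # leaf (if x q then D\<^sub>1 else D\<^sub>0) x"

definition cost :: "'q dtree \<Rightarrow> ('q \<Rightarrow> bool) \<Rightarrow> nat" where
  "cost D x = length (leaf D x)"

definition leaf_set :: "('q \<Rightarrow> bool) set \<Rightarrow> 'q dtree \<Rightarrow> ('q \<Rightarrow> bool) \<Rightarrow> ('q \<Rightarrow> bool) set" where
  "leaf_set Y D x = {x' \<in> Y. leaf D x' = leaf D x}"

text \<open>The set \<open>Y\<close> is the domain of the partial function \<open>g\<close>, and \<open>Out\<close> is its finite codomain.\<close>

definition success ::
  "('q \<Rightarrow> bool) set \<Rightarrow> 'o set \<Rightarrow> (('q \<Rightarrow> bool) \<Rightarrow> 'o) \<Rightarrow> ('q \<Rightarrow> bool) pmf \<Rightarrow> ('q \<Rightarrow> bool) set \<Rightarrow> real"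
where
  "success Y Out g \<nu> L =
     Max ((\<lambda>y. measure_pmf.prob \<nu> (L \<inter> {x \<in> Y. g x = y}) / measure_pmf.prob \<nu> L) ` Out)"

definition success_bar ::
  "('q \<Rightarrow> bool) set \<Rightarrow> 'o set \<Rightarrow> (('q \<Rightarrow> bool) \<Rightarrow> 'o) \<Rightarrow> ('q \<Rightarrow> bool) pmf \<Rightarrow> 'q dtree pmf \<Rightarrow> real"
where
  "success_bar Y Out g \<nu> R =
     measure_pmf.expectation (pair_pmf R \<nu>) (\<lambda>(D, x). success Y Out g \<nu> (leaf_set Y D x))"

text \<open>The numerator is taken in \<^typ>\<open>ennreal\<close>: trees may be arbitrarily deep, so the expected
  cost of a distribution over trees may be infinite, where the Bochner integral would be 0.\<close>

definition scost_bar ::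
  "('q \<Rightarrow> bool) set \<Rightarrow> 'o set \<Rightarrow> (('q \<Rightarrow> bool) \<Rightarrow> 'o) \<Rightarrow> ('q \<Rightarrow> bool) pmf \<Rightarrow> 'q dtree pmf \<Rightarrow> ennreal"
where
  "scost_bar Y Out g \<nu> R =
     (\<integral>\<^sup>+ (D, x). ennreal (success Y Out g \<nu> (leaf_set Y D x) * real (cost D x))
        \<partial>measure_pmf (pair_pmf R \<nu>))
     / ennreal (success_bar Y Out g \<nu> R)"

text \<open>The outer extremum is a supremum because it need not be attained: the inner minimum is only
  lower semicontinuous in \<open>\<nu>\<close>.\<close>

definition sR ::
  "real \<Rightarrow> 'q set \<Rightarrow> ('q \<Rightarrow> bool) set \<Rightarrow> 'o set \<Rightarrow> (('q \<Rightarrow> bool) \<Rightarrow> 'o) \<Rightarrow> ennreal"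
where
  "sR \<gamma> Q Y Out g =
     (SUP \<nu>\<in>{\<nu>. set_pmf \<nu> \<subseteq> Y}.
        INF R\<in>{R. set_pmf R \<subseteq> dtrees Q \<and> success_bar Y Out g \<nu> R \<ge> \<gamma>}. scost_bar Y Out g \<nu> R)"

definition instance_of :: "(nat \<times> nat \<Rightarrow> bool) \<Rightarrow> nat \<Rightarrow> nat \<Rightarrow> bool" where
  "instance_of z j = (\<lambda>i. z (j, i))"

definition dom_power :: "nat \<Rightarrow> nat \<Rightarrow> (nat \<Rightarrow> bool) set \<Rightarrow> (nat \<times> nat \<Rightarrow> bool) set" where
  "dom_power m n X = {z \<in> ({..<n} \<times> {..<m}) \<rightarrow>\<^sub>E UNIV. \<forall>j<n. instance_of z j \<in> X}"

definition fun_power :: "nat \<Rightarrow> ((nat \<Rightarrow> bool) \<Rightarrow> bool) \<Rightarrow> (nat \<times> nat \<Rightarrow> bool) \<Rightarrow> bool list" where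
  "fun_power n f z = map (\<lambda>j. f (instance_of z j)) [0..<n]"

end

theory Submission
  imports Defs
begin

text \<open>
  For \<open>\<epsilon> > 0\<close> consider the discounted score \<open>E[success \<cdot> exp (- \<epsilon> \<cdot> cost)]\<close>. Under a product
  distribution a query affects the posterior of one instance only, so the optimal discounted score
  of \<open>f\<^sup>n\<close> is at most the \<open>n\<close>-th power of that of \<open>f\<close>. An algorithm for \<open>f\<^sup>n\<close> with success
  \<open>\<gamma>\<^sup>n\<close> and success-conditioned cost \<open>T\<close> has discounted score at least \<open>\<gamma>\<^sup>n exp (- \<epsilon> T)\<close> by
  Jensen's inequality; hence for every \<open>\<epsilon>\<close> and every \<open>t > T / n\<close> some tree for \<open>f\<close> has discounted
  score above \<open>\<gamma> exp (- \<epsilon> t)\<close>. Stopping that tree at depth \<open>1 / \<epsilon>\<close> costs little, because every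
  leaf of a Boolean function has success at least \<open>1/2\<close>, more than the discount \<open>1/e\<close>
  collected beyond that depth. For the truncated tree the linear score
  \<open>E[success \<cdot> (1 - \<epsilon> cost / 8)]\<close> is then at least \<open>\<gamma> (1 - \<epsilon> t)\<close>. Since this holds for all
  Lagrange multipliers \<open>\<epsilon>\<close>, a mixture of two trees achieves success \<open>\<gamma>\<close> with
  success-conditioned cost \<open>8 t\<close>.
\<close>

section \<open>Trees as functionals on sets of inputs\<close>

text \<open>\<open>F L\<close> is the weight of a leaf and \<open>h k\<close> the factor for depth
  \<open>k\<close>; shifting \<open>h\<close> at each query replaces a depth counter. With
  \<open>h\<close> equal to \<open>1\<close>, \<open>real\<close> or an exponential this yields
  success, the cost numerator and the discounted score.\<close>

fun tree_val :: "(('q \<Rightarrow> bool) set \<Rightarrow> real) \<Rightarrow> (nat \<Rightarrow> real) \<Rightarrow> 'q dtree \<Rightarrow> ('q \<Rightarrow> bool) set \<Rightarrow> real"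
where
  "tree_val F h Leaf L = h 0 * F L"
| "tree_val F h (Query q D\<^sub>0 D\<^sub>1) L =
     tree_val F (\<lambda>k. h (Suc k)) D\<^sub>0 {x \<in> L. \<not> x q} + tree_val F (\<lambda>k. h (Suc k)) D\<^sub>1 {x \<in> L. x q}"

lemma tree_val_linear:
  "tree_val F (\<lambda>k. a * h k + b * h' k) D L = a * tree_val F h D L + b * tree_val F h' D L"
  by (induction D arbitrary: h h' L) (auto simp: algebra_simps)

lemma tree_val_cmult: "tree_val F (\<lambda>k. a * h k) D L = a * tree_val F h D L"
  using tree_val_linear[of F a h 0 h D L] by simp

lemma tree_val_nonneg:
  assumes "\<And>L. 0 \<le> F L" and "\<And>k. 0 \<le> h k"
  shows "0 \<le> tree_val F h D L"
  using assms(2) by (induction D arbitrary: h L) (auto simp: assms(1))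

lemma leaf_set_Query:
  assumes "x \<in> L"
  shows "leaf_set L (Query q D\<^sub>0 D\<^sub>1) x =
    (if x q then leaf_set {x \<in> L. x q} D\<^sub>1 x else leaf_set {x \<in> L. \<not> x q} D\<^sub>0 x)"
  using assms by (auto simp: leaf_set_def)

section \<open>Success and cost under a fixed input distribution\<close>

locale dist_problem =
  fixes Y :: "('q \<Rightarrow> bool) set" and Out :: "'o set" and g :: "('q \<Rightarrow> bool) \<Rightarrow> 'o"
    and \<nu> :: "('q \<Rightarrow> bool) pmf"
  assumes finite_Y: "finite Y" and supp: "set_pmf \<nu> \<subseteq> Y"
    and finite_Out: "finite Out" and Out_ne: "Out \<noteq> {}"
begin

text \<open>Unnormalised success: the probability of reaching the leaf and being right there. It
  avoids the quotient, which is degenerate on null leaves.\<close>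

definition best :: "('q \<Rightarrow> bool) set \<Rightarrow> real" where
  "best L = Max ((\<lambda>y. measure_pmf.prob \<nu> (L \<inter> {x \<in> Y. g x = y})) ` Out)"

lemma best_nonneg: "0 \<le> best L"
  using Out_ne finite_Out unfolding best_def by (subst Max_ge_iff) auto

lemma best_le_prob: "best L \<le> measure_pmf.prob \<nu> L"
  using Out_ne finite_Out unfolding best_def
  by (subst Max_le_iff) (auto intro!: measure_pmf.finite_measure_mono)

lemma prob_times_success:
  "measure_pmf.prob \<nu> L * success Y Out g \<nu> L = best L"
proof (cases "measure_pmf.prob \<nu> L = 0")
  case True
  then show ?thesis using best_nonneg[of L] best_le_prob[of L] by simp
next
  case False
  then have p: "measure_pmf.prob \<nu> L > 0" by (simp add: zero_less_measure_iff)
  have "best L / measure_pmf.prob \<nu> L =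
    Max ((\<lambda>t. t / measure_pmf.prob \<nu> L) `
      ((\<lambda>y. measure_pmf.prob \<nu> (L \<inter> {x \<in> Y. g x = y})) ` Out))"
    unfolding best_def using Out_ne finite_Out
    by (intro mono_Max_commute) (auto simp: mono_def divide_right_mono)
  then have "best L / measure_pmf.prob \<nu> L = success Y Out g \<nu> L"
    by (simp add: success_def image_image)
  with p show ?thesis by (simp add: field_simps)
qed

lemma success_nonneg: "0 \<le> success Y Out g \<nu> L"
  using Out_ne finite_Out unfolding success_def by (subst Max_ge_iff) auto

lemma success_le_1: "success Y Out g \<nu> L \<le> 1"
  using Out_ne finite_Out unfolding success_def
  by (subst Max_le_iff)
     (auto simp: divide_le_eq_1 zero_less_measure_iff intro!: measure_pmf.finite_measure_mono)

text \<open>Inputs are grouped by leaf, where mass times \<open>success\<close> equals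
  \<open>best\<close>. A general \<open>L\<close> is needed because every query splits the input
  set.\<close>

lemma sum_success_eq_tree_val:
  assumes "L \<subseteq> Y"
  shows "(\<Sum>x\<in>L. success Y Out g \<nu> (leaf_set L D x) * h (cost D x) * pmf \<nu> x) = tree_val best h D L"
  using assms
proof (induction D arbitrary: h L)
  case Leaf
  have "finite L" using Leaf finite_Y finite_subset by blast
  then have "(\<Sum>x\<in>L. success Y Out g \<nu> L * h 0 * pmf \<nu> x)
      = h 0 * (measure_pmf.prob \<nu> L * success Y Out g \<nu> L)"
    by (simp add: measure_measure_pmf_finite sum_distrib_left[symmetric])
  then show ?case by (simp add: prob_times_success leaf_set_def cost_def)
next
  case (Query q D0 D1)
  have fin: "finite L" using Query.prems finite_Y finite_subset by blast
  let ?t = "\<lambda>x. success Y Out g \<nu> (leaf_set L (Query q D0 D1) x) * h (cost (Query q D0 D1) x) * pmf \<nu> x"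
  have "L = {x \<in> L. \<not> x q} \<union> {x \<in> L. x q}" by auto
  then have "sum ?t L = sum ?t ({x \<in> L. \<not> x q} \<union> {x \<in> L. x q})" by simp
  also have "\<dots> = sum ?t {x \<in> L. \<not> x q} + sum ?t {x \<in> L. x q}"
    using fin by (intro sum.union_disjoint) auto
  also have "sum ?t {x \<in> L. \<not> x q} = tree_val best (\<lambda>k. h (Suc k)) D0 {x \<in> L. \<not> x q}"
    using Query.prems
    by (subst Query.IH(1)[symmetric]) (auto intro!: sum.cong simp: leaf_set_Query cost_def)
  also have "sum ?t {x \<in> L. x q} = tree_val best (\<lambda>k. h (Suc k)) D1 {x \<in> L. x q}"
    using Query.prems
    by (subst Query.IH(2)[symmetric]) (auto intro!: sum.cong simp: leaf_set_Query cost_def)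
  finally show ?case by simp
qed

lemma nn_integral_success:
  assumes h: "\<And>k. 0 \<le> h k"
  shows "(\<integral>\<^sup>+ (D, x). ennreal (success Y Out g \<nu> (leaf_set Y D x) * h (cost D x))
            \<partial>measure_pmf (pair_pmf R \<nu>))
         = (\<integral>\<^sup>+ D. ennreal (tree_val best h D Y) \<partial>measure_pmf R)"
proof -
  have "(\<integral>\<^sup>+ x. ennreal (success Y Out g \<nu> (leaf_set Y D x) * h (cost D x)) \<partial>measure_pmf \<nu>)
      = ennreal (tree_val best h D Y)" for D
    using finite_Y supp h success_nonneg
    by (subst nn_integral_measure_pmf_support[of Y])
       (auto simp: sum_success_eq_tree_val[symmetric] ennreal_mult'[symmetric] simp flip: sum_ennreal
          intro!: sum.cong)
  then show ?thesis by (simp add: nn_integral_pair_pmf')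
qed

lemma ennreal_success_bar:
  "ennreal (success_bar Y Out g \<nu> R) = (\<integral>\<^sup>+ D. ennreal (tree_val best (\<lambda>_. 1) D Y) \<partial>measure_pmf R)"
proof -
  have "ennreal (success_bar Y Out g \<nu> R) =
    (\<integral>\<^sup>+ z. ennreal ((\<lambda>(D, x). success Y Out g \<nu> (leaf_set Y D x)) z) \<partial>measure_pmf (pair_pmf R \<nu>))"
    unfolding success_bar_def
    using success_nonneg success_le_1
    by (intro nn_integral_eq_integral[symmetric] measure_pmf.integrable_const_bound[where B = 1])
       (auto simp: case_prod_unfold)
  also have "\<dots> = (\<integral>\<^sup>+ (D, x). ennreal (success Y Out g \<nu> (leaf_set Y D x) * 1)
            \<partial>measure_pmf (pair_pmf R \<nu>))"
    by (auto intro!: nn_integral_cong simp: case_prod_unfold)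
  finally show ?thesis using nn_integral_success[of "\<lambda>_. 1"] by simp
qed

lemma scost_bar_eq:
  "scost_bar Y Out g \<nu> R =
     (\<integral>\<^sup>+ D. ennreal (tree_val best real D Y) \<partial>measure_pmf R) / ennreal (success_bar Y Out g \<nu> R)"
  unfolding scost_bar_def by (subst nn_integral_success) auto

lemma success_bar_nonneg: "0 \<le> success_bar Y Out g \<nu> R"
  unfolding success_bar_def using success_nonneg by (intro Bochner_Integration.integral_nonneg) auto

lemma tree_val_upper:
  assumes "0 \<le> G" and "\<And>k. h k \<le> G"
  shows "tree_val best h D L \<le> G * measure_pmf.prob \<nu> L"
  using assms(2)
proof (induction D arbitrary: h L)
  case Leaf
  have "h 0 * best L \<le> G * best L" using Leaf best_nonneg by (intro mult_right_mono) auto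
  also have "\<dots> \<le> G * measure_pmf.prob \<nu> L" using assms(1) best_le_prob by (intro mult_left_mono)
  finally show ?case by simp
next
  case (Query q D0 D1)
  have "tree_val best h (Query q D0 D1) L
      \<le> G * measure_pmf.prob \<nu> {x \<in> L. \<not> x q} + G * measure_pmf.prob \<nu> {x \<in> L. x q}"
    using Query by (auto intro!: add_mono)
  also have "\<dots> = G * measure_pmf.prob \<nu> ({x \<in> L. \<not> x q} \<union> {x \<in> L. x q})"
    by (subst measure_pmf.finite_measure_Union) (auto simp: distrib_left)
  also have "{x \<in> L. \<not> x q} \<union> {x \<in> L. x q} = L" by auto
  finally show ?case .
qed

text \<open>Trees may be arbitrarily deep, but success depends only on which inputs share a leaf,
  and a finite \<open>Y\<close> has finitely many partitions.\<close>

lemma finite_success_values: "finite (range (\<lambda>D. tree_val best (\<lambda>_. 1) D Y))"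
proof -
  have "tree_val best (\<lambda>_. 1) D Y =
      (\<Sum>x\<in>Y. success Y Out g \<nu> (restrict (leaf_set Y D) Y x) * pmf \<nu> x)" for D
    by (subst sum_success_eq_tree_val[symmetric]) auto
  moreover have "restrict (leaf_set Y D) Y \<in> Y \<rightarrow>\<^sub>E Pow Y" for D
    by (auto simp: leaf_set_def)
  ultimately have "range (\<lambda>D. tree_val best (\<lambda>_. 1) D Y)
      \<subseteq> (\<lambda>s. \<Sum>x\<in>Y. success Y Out g \<nu> (s x) * pmf \<nu> x) ` (Y \<rightarrow>\<^sub>E Pow Y)"
    by blast
  moreover have "finite (Y \<rightarrow>\<^sub>E Pow Y)" using finite_Y by (intro finite_PiE) auto
  ultimately show ?thesis using finite_subset by blast
qed

text \<open>Success and the cost numerator are linear in the algorithm, so mixing two trees realises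
  every point of the segment between their values.\<close>

lemma two_point_mixture:
  fixes p :: real and D0 D1 :: "'q dtree"
  assumes p: "0 \<le> p" "p \<le> 1"
  defines "R \<equiv> map_pmf (\<lambda>b. if b then D1 else D0) (bernoulli_pmf p)"
  shows "success_bar Y Out g \<nu> R
           = p * tree_val best (\<lambda>_. 1) D1 Y + (1 - p) * tree_val best (\<lambda>_. 1) D0 Y" (is ?S)
    and "scost_bar Y Out g \<nu> R = ennreal (p * tree_val best real D1 Y + (1 - p) * tree_val best real D0 Y)
           / ennreal (success_bar Y Out g \<nu> R)" (is ?C)
proof -
  have int: "(\<integral>\<^sup>+ D. ennreal (tree_val best h D Y) \<partial>measure_pmf R)
      = ennreal (p * tree_val best h D1 Y + (1 - p) * tree_val best h D0 Y)"
    if "\<And>k. 0 \<le> h k" for h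
    using p tree_val_nonneg[of best h, OF best_nonneg that]
    by (simp add: R_def ennreal_mult mult.commute ennreal_plus)
  have "ennreal (success_bar Y Out g \<nu> R)
      = ennreal (p * tree_val best (\<lambda>_. 1) D1 Y + (1 - p) * tree_val best (\<lambda>_. 1) D0 Y)"
    unfolding ennreal_success_bar by (rule int) simp
  then show ?S
    using p success_bar_nonneg tree_val_nonneg[of best "\<lambda>_. 1", OF best_nonneg]
    by (subst (asm) ennreal_inj) auto
  show ?C unfolding scost_bar_eq by (subst int) auto
qed

text \<open>Jensen's inequality for the measure reweighted by success, using the tangent of \<open>exp\<close> at the
  conditional mean \<open>T\<close>.\<close>

lemma discounted_ge_scost:
  assumes T: "scost_bar Y Out g \<nu> R = ennreal T" "0 \<le> T" and S: "0 < success_bar Y Out g \<nu> R"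
    and \<epsilon>: "0 \<le> \<epsilon>" and V: "0 \<le> V"
      "\<And>D. D \<in> set_pmf R \<Longrightarrow> tree_val best (\<lambda>k. exp (- \<epsilon> * real k)) D Y \<le> V"
  shows "success_bar Y Out g \<nu> R * exp (- \<epsilon> * T) \<le> V"
proof -
  define S where "S = success_bar Y Out g \<nu> R"
  define N where "N = (\<integral>\<^sup>+ D. ennreal (tree_val best real D Y) \<partial>measure_pmf R)"
  have S0: "0 < S" using S by (simp add: S_def)
  have "N / ennreal S = ennreal T" using T(1) by (simp add: scost_bar_eq S_def N_def)
  \<comment> \<open>An infinite \<open>N\<close> is excluded because its quotient by
    \<open>S\<close> would be infinite too.\<close>
  then have N: "N = ennreal (T * S)"
    using S0 T(2)
    by (cases N) (auto simp: divide_ennreal ennreal_top_divide field_simps)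
  define e where "e = exp (- \<epsilon> * T)"
  have e0: "0 < e" by (simp add: e_def)
  have tangent: "e * (1 + \<epsilon> * T) \<le> exp (- \<epsilon> * real k) + e * \<epsilon> * real k" for k
  proof -
    have "1 + \<epsilon> * (T - real k) \<le> exp (\<epsilon> * (T - real k))" by (rule exp_ge_add_one_self)
    then have "e * (1 + \<epsilon> * (T - real k)) \<le> e * exp (\<epsilon> * (T - real k))" using e0 by simp
    also have "\<dots> = exp (- \<epsilon> * real k)" by (simp add: e_def mult_exp_exp algebra_simps)
    finally show ?thesis by (simp add: algebra_simps)
  qed
  have mono: "tree_val best h D L \<le> tree_val best h' D L" if "\<And>k. h k \<le> h' k" for h h' D L
    using tree_val_nonneg[of best "\<lambda>k. 1 * h' k + (-1) * h k" D L] best_nonneg that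
    by (simp only: tree_val_linear) simp
  have pt: "e * (1 + \<epsilon> * T) * tree_val best (\<lambda>_. 1) D Y
      \<le> tree_val best (\<lambda>k. exp (- \<epsilon> * real k)) D Y + e * \<epsilon> * tree_val best real D Y" for D
    using mono[of "\<lambda>_. e * (1 + \<epsilon> * T) * 1" "\<lambda>k. 1 * exp (- \<epsilon> * real k) + e * \<epsilon> * real k" D Y] tangent
    by (simp only: tree_val_linear tree_val_cmult) simp
  have nn: "0 \<le> tree_val best (\<lambda>_. 1) D Y" "0 \<le> tree_val best real D Y" for D
    using best_nonneg by (auto intro: tree_val_nonneg)
  \<comment> \<open>The cost term is kept on the right with a plus sign, so that both sides are
    nonnegative and can be integrated in \<open>ennreal\<close>; it cancels at the end.\<close>
  have "ennreal (e * (1 + \<epsilon> * T) * S)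
      = (\<integral>\<^sup>+ D. ennreal (e * (1 + \<epsilon> * T)) * ennreal (tree_val best (\<lambda>_. 1) D Y) \<partial>measure_pmf R)"
    using S0 e0 \<epsilon> T(2)
    by (simp add: nn_integral_cmult ennreal_success_bar[symmetric] S_def ennreal_mult)
  also have "\<dots> \<le> (\<integral>\<^sup>+ D. ennreal V + ennreal (e * \<epsilon>) * ennreal (tree_val best real D Y) \<partial>measure_pmf R)"
  proof (intro nn_integral_mono_AE, simp add: AE_measure_pmf_iff, intro ballI)
    fix D assume "D \<in> set_pmf R"
    then have "e * (1 + \<epsilon> * T) * tree_val best (\<lambda>_. 1) D Y \<le> V + e * \<epsilon> * tree_val best real D Y"
      using pt[of D] V(2)[of D] by simp
    then have "ennreal (e * (1 + \<epsilon> * T) * tree_val best (\<lambda>_. 1) D Y)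
        \<le> ennreal (V + e * \<epsilon> * tree_val best real D Y)"
      by (rule ennreal_leI)
    then show "ennreal (e * (1 + \<epsilon> * T)) * ennreal (tree_val best (\<lambda>_. 1) D Y)
        \<le> ennreal V + ennreal (e * \<epsilon>) * ennreal (tree_val best real D Y)"
      using nn[of D] e0 \<epsilon> T(2) V(1) by (simp add: ennreal_mult[symmetric] flip: ennreal_plus)
  qed
  also have "\<dots> = ennreal (V + e * \<epsilon> * (T * S))"
    using S0 e0 \<epsilon> T(2) V(1)
    by (simp add: nn_integral_add nn_integral_cmult N N_def[symmetric] ennreal_mult[symmetric]
          flip: ennreal_plus)
  finally have "e * (1 + \<epsilon> * T) * S \<le> V + e * \<epsilon> * (T * S)"
    using S0 e0 \<epsilon> T(2) V(1) by (subst (asm) ennreal_le_iff) auto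
  then show ?thesis unfolding S_def[symmetric] e_def[symmetric] by (simp add: algebra_simps)
qed

end

section \<open>Truncation\<close>

fun trunc :: "nat \<Rightarrow> 'q dtree \<Rightarrow> 'q dtree" where
  "trunc d Leaf = Leaf"
| "trunc 0 (Query q D\<^sub>0 D\<^sub>1) = Leaf"
| "trunc (Suc d) (Query q D\<^sub>0 D\<^sub>1) = Query q (trunc d D\<^sub>0) (trunc d D\<^sub>1)"

lemma set_dtree_trunc: "set_dtree (trunc d D) \<subseteq> set_dtree D"
  by (induction d D rule: trunc.induct) auto

text \<open>A subtree below the cut collects at most \<open>G\<close> times the mass of its input
  set, hence at most \<open>2 * G\<close> times \<open>best\<close> by \<open>half\<close>; the leaf
  replacing it earns the factor \<open>h' d\<close>, which is no less.\<close>

lemma (in dist_problem) tree_val_le_trunc: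
  assumes half: "\<And>L. L \<subseteq> Y \<Longrightarrow> measure_pmf.prob \<nu> L \<le> 2 * best L" and G: "0 \<le> G"
    and "L \<subseteq> Y"
    and "\<And>k. k \<le> d \<Longrightarrow> h k \<le> h' k" "\<And>k. d < k \<Longrightarrow> h k \<le> G" "2 * G \<le> h' d"
  shows "tree_val best h D L \<le> tree_val best h' (trunc d D) L"
  using assms(3-)
proof (induction d D arbitrary: h h' L rule: trunc.induct)
  case (1 d)
  then show ?case using best_nonneg by (auto intro: mult_right_mono)
next
  case (2 q D0 D1)
  \<comment> \<open>A query node has no leaf at depth 0, so \<open>h 0\<close>, which
    \<open>G\<close> need not bound, can be reset to 0.\<close>
  have "tree_val best h (Query q D0 D1) L
      = tree_val best (\<lambda>k. if k = 0 then 0 else h k) (Query q D0 D1) L"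
    by simp
  also have "\<dots> \<le> G * measure_pmf.prob \<nu> L"
    using G 2 by (intro tree_val_upper) auto
  also have "\<dots> \<le> G * (2 * best L)" using half 2 G by (intro mult_left_mono) auto
  also have "\<dots> = (2 * G) * best L" by simp
  also have "\<dots> \<le> h' 0 * best L" using 2 best_nonneg by (intro mult_right_mono) auto
  finally show ?case by simp
next
  case (3 d q D0 D1)
  have "tree_val best (\<lambda>k. h (Suc k)) D0 {x \<in> L. \<not> x q}
      \<le> tree_val best (\<lambda>k. h' (Suc k)) (trunc d D0) {x \<in> L. \<not> x q}"
    using 3 by (intro 3(1)) auto
  moreover have "tree_val best (\<lambda>k. h (Suc k)) D1 {x \<in> L. x q}
      \<le> tree_val best (\<lambda>k. h' (Suc k)) (trunc d D1) {x \<in> L. x q}"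
    using 3 by (intro 3(2)) auto
  ultimately show ?case by simp
qed

text \<open>The slope 1/8 is small enough for both \<open>exp (- x) \<le> 1 - x / 8\<close> on
  [0, 1], which compares the leaves kept, and \<open>2 * exp (-1) \<le> 7 / 8\<close>, which pays
  for the subtrees removed.\<close>

lemma (in dist_problem) linear_ge_discounted:
  assumes half: "\<And>L. L \<subseteq> Y \<Longrightarrow> measure_pmf.prob \<nu> L \<le> 2 * best L" and \<epsilon>: "0 < \<epsilon>"
  shows "tree_val best (\<lambda>k. exp (- \<epsilon> * real k)) D Y
    \<le> tree_val best (\<lambda>k. 1 - \<epsilon> / 8 * real k) (trunc (nat \<lfloor>1 / \<epsilon>\<rfloor>) D) Y"
proof (rule tree_val_le_trunc[OF half, where G = "exp (-1)"])
  define d where "d = nat \<lfloor>1 / \<epsilon>\<rfloor>"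
  have small: "\<epsilon> * real k \<le> 1" if "k \<le> d" for k
  proof -
    have "real k \<le> real d" using that by simp
    also have "real d \<le> 1 / \<epsilon>" using \<epsilon> by (simp add: d_def)
    finally show ?thesis using \<epsilon> by (simp add: field_simps)
  qed
  show "exp (- \<epsilon> * real k) \<le> 1 - \<epsilon> / 8 * real k" if "k \<le> nat \<lfloor>1 / \<epsilon>\<rfloor>" for k
  proof -
    define x where "x = \<epsilon> * real k"
    have x: "0 \<le> x" "x \<le> 1" using small[of k] that \<epsilon> by (auto simp: x_def d_def)
    have "1 \<le> (1 + x) * (1 - x / 8)" using x mult_left_mono[of x 1 x] by (simp add: algebra_simps)
    also have "\<dots> \<le> exp x * (1 - x / 8)" using x by (intro mult_right_mono exp_ge_add_one_self) auto
    finally show ?thesis by (simp add: x_def exp_minus field_simps)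
  qed
  show "exp (- \<epsilon> * real k) \<le> exp (-1)" if "nat \<lfloor>1 / \<epsilon>\<rfloor> < k" for k
  proof -
    have "1 / \<epsilon> < real k" using that \<epsilon> by linarith
    then show ?thesis using \<epsilon> by (simp add: field_simps)
  qed
  have "(5/2::real) \<le> exp 1" using exp_lower_Taylor_quadratic[of 1] by simp
  then have "2 * exp (-1) \<le> (7/8::real)" by (simp add: exp_minus field_simps)
  then show "2 * exp (-1) \<le> 1 - \<epsilon> / 8 * real (nat \<lfloor>1 / \<epsilon>\<rfloor>)"
    using small[of d] by (simp add: d_def)
qed auto

section \<open>Lagrange multipliers\<close>

text \<open>A supporting line of the convex hull of the points \<open>(S D, C D)\<close>; finiteness of the range of
  \<open>S\<close> keeps its slope finite even when \<open>\<gamma>\<close> is the largest value of \<open>S\<close>.\<close>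

lemma lagrange_multiplier:
  fixes S C :: "'a \<Rightarrow> real"
  assumes fin: "finite (S ` A)" and C: "\<And>D. D \<in> A \<Longrightarrow> 0 \<le> C D" and a: "a \<in> A" "C a = 0" and u: "0 < u"
    and mix: "\<And>D0 D1 p. \<lbrakk>D0 \<in> A; D1 \<in> A; 0 \<le> p; p \<le> 1; \<gamma> \<le> p * S D1 + (1 - p) * S D0\<rbrakk>
        \<Longrightarrow> u \<le> p * C D1 + (1 - p) * C D0"
  shows "\<exists>l>0. \<forall>D\<in>A. S D - l * C D \<le> \<gamma> - l * u"
proof -
  have single: "u \<le> C D" if "D \<in> A" "\<gamma> \<le> S D" for D
    using mix[of D D 1] that by simp
  have Sa: "S a < \<gamma>" using single[of a] a u by force
  \<comment> \<open>\<open>B\<close> holds the points left of \<open>\<gamma>\<close>, and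
    \<open>slope D\<close> belongs to the line joining the point of \<open>D\<close> to
    \<open>(\<gamma>, u)\<close>. The supremum of these slopes gives the supporting line.\<close>
  define B where "B = {D \<in> A. S D < \<gamma>}"
  define slope where "slope D = (u - C D) / (\<gamma> - S D)" for D
  define k where "k = (SUP D\<in>B. slope D)"
  have aB: "a \<in> B" using a Sa by (simp add: B_def)
  have finB: "finite (S ` B)" using fin by (rule finite_subset[rotated]) (auto simp: B_def)
  \<comment> \<open>The denominators stay away from 0 since \<open>S\<close> takes finitely many
    values, and the numerators are at most \<open>u\<close>.\<close>
  have "bdd_above (slope ` B)"
  proof (rule bdd_aboveI2)
    fix D assume D: "D \<in> B"
    define s where "s = Max (S ` B)"
    have "s \<in> S ` B" using finB aB unfolding s_def by (intro Max_in) auto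
    then have s: "s < \<gamma>" by (auto simp: B_def)
    have "S D \<le> s" using D finB by (auto simp: s_def)
    then show "slope D \<le> u / (\<gamma> - s)"
      unfolding slope_def using D s u C[of D] by (intro frac_le) (auto simp: B_def)
  qed
  then have k_ge: "slope D \<le> k" if "D \<in> B" for D
    using that unfolding k_def by (rule cSUP_upper2) auto
  \<comment> \<open>The zero-cost point \<open>a\<close> forces a positive slope, so
    \<open>1 / k\<close> can serve as the multiplier.\<close>
  have "0 < slope a" using a u Sa by (simp add: slope_def)
  then have k0: "0 < k" using k_ge[OF aB] by linarith
  have line: "k * (S D - \<gamma>) \<le> C D - u" if D: "D \<in> A" for D
  proof -
    consider "S D < \<gamma>" | "S D = \<gamma>" | "S D > \<gamma>" by linarith
    then show ?thesis
    proof cases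
      case 1
      then have "slope D \<le> k" using k_ge D by (simp add: B_def)
      then show ?thesis using 1 by (simp add: slope_def field_simps)
    next
      case 2
      then show ?thesis using single[of D] D by simp
    next
      case 3
      have "k \<le> (C D - u) / (S D - \<gamma>)"
        unfolding k_def
      proof (rule cSUP_least)
        show "B \<noteq> {}" using aB by auto
        fix E assume "E \<in> B"
        then have E: "E \<in> A" "S E < \<gamma>" by (auto simp: B_def)
        \<comment> \<open>The weight at which the mixture of \<open>E\<close> and \<open>D\<close>
          has success exactly \<open>\<gamma>\<close>; by \<open>mix\<close> the segment passes on
          or above \<open>(\<gamma>, u)\<close> there, which compares the two slopes.\<close>
        define p where "p = (\<gamma> - S E) / (S D - S E)"
        have p: "0 \<le> p" "p \<le> 1" using E 3 by (auto simp: p_def)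
        have pe: "p * (S D - S E) = \<gamma> - S E" using E 3 by (simp add: p_def)
        have "u \<le> p * C D + (1 - p) * C E"
          using pe by (intro mix D E p) (simp add: algebra_simps)
        then have "(u - C E) * (S D - S E) \<le> p * (C D - C E) * (S D - S E)"
          using E 3 by (intro mult_right_mono) (auto simp: algebra_simps)
        also have "\<dots> = (p * (S D - S E)) * (C D - C E)" by simp
        finally have "(u - C E) * (S D - S E) \<le> (\<gamma> - S E) * (C D - C E)" by (simp only: pe)
        then show "slope E \<le> (C D - u) / (S D - \<gamma>)"
          unfolding slope_def using E 3 by (simp add: divide_simps) (simp add: algebra_simps)
      qed
      then show ?thesis using 3 by (simp add: field_simps)
    qed
  qed
  have "\<forall>D\<in>A. S D - 1 / k * C D \<le> \<gamma> - 1 / k * u"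
  proof
    fix D assume "D \<in> A"
    then have "1 / k * (k * (S D - \<gamma>)) \<le> 1 / k * (C D - u)"
      using line k0 by (intro mult_left_mono) auto
    then show "S D - 1 / k * C D \<le> \<gamma> - 1 / k * u"
      using k0 by (simp add: right_diff_distrib)
  qed
  then show ?thesis using k0 by (intro exI[of _ "1 / k"]) auto
qed

section \<open>Product distributions\<close>

definition assemble :: "nat \<Rightarrow> nat \<Rightarrow> (nat \<Rightarrow> nat \<Rightarrow> bool) \<Rightarrow> nat \<times> nat \<Rightarrow> bool" where
  "assemble m n w = (\<lambda>(j, i). if j < n \<and> i < m then w j i else undefined)"

definition pmf_power :: "nat \<Rightarrow> nat \<Rightarrow> (nat \<Rightarrow> bool) pmf \<Rightarrow> (nat \<times> nat \<Rightarrow> bool) pmf" where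
  "pmf_power m n \<mu> = map_pmf (assemble m n) (Pi_pmf {..<n} undefined (\<lambda>_. \<mu>))"

text \<open>The sets that a tree for the product problem produces: a query restricts one factor and
  keeps the product form.\<close>

definition box :: "nat \<Rightarrow> nat \<Rightarrow> (nat \<Rightarrow> bool) set \<Rightarrow> (nat \<Rightarrow> (nat \<Rightarrow> bool) set) \<Rightarrow> (nat \<times> nat \<Rightarrow> bool) set"
where
  "box m n X L = {z \<in> dom_power m n X. \<forall>j<n. instance_of z j \<in> L j}"

lemma instance_of_assemble:
  assumes "w j \<in> {..<m} \<rightarrow>\<^sub>E UNIV" and "j < n"
  shows "instance_of (assemble m n w) j = w j"
  using assms by (auto simp: instance_of_def assemble_def PiE_def extensional_def)

lemma set_pmf_power:
  assumes "X \<subseteq> {..<m} \<rightarrow>\<^sub>E UNIV" and "set_pmf \<mu> \<subseteq> X"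
  shows "set_pmf (pmf_power m n \<mu>) \<subseteq> dom_power m n X"
proof -
  have "assemble m n w \<in> dom_power m n X" if w: "\<And>j. j < n \<Longrightarrow> w j \<in> X" for w
  proof -
    have "instance_of (assemble m n w) j \<in> X" if "j < n" for j
      using instance_of_assemble[of w j m n] w[of j] that assms(1) by auto
    moreover have "assemble m n w \<in> ({..<n} \<times> {..<m}) \<rightarrow>\<^sub>E UNIV"
      by (auto simp: assemble_def PiE_def extensional_def)
    ultimately show ?thesis by (simp add: dom_power_def)
  qed
  then show ?thesis
    using assms(2) by (auto simp: pmf_power_def set_Pi_pmf PiE_dflt_def)
qed

lemma prob_power_le:
  assumes "X \<subseteq> {..<m} \<rightarrow>\<^sub>E UNIV" and "set_pmf \<mu> \<subseteq> X"
    and B: "\<And>z. z \<in> B \<Longrightarrow> \<forall>j<n. instance_of z j \<in> A j"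
  shows "measure_pmf.prob (pmf_power m n \<mu>) B \<le> (\<Prod>j<n. measure_pmf.prob \<mu> (A j))"
proof -
  let ?P = "Pi_pmf {..<n} undefined (\<lambda>_. \<mu>)"
  \<comment> \<open>Only the support matters: there every \<open>w j\<close> with
    \<open>j < n\<close> is extensional, so \<open>instance_of\<close> recovers it from the
    assembled string.\<close>
  have "measure_pmf.prob (pmf_power m n \<mu>) B
      = measure_pmf.prob ?P ((assemble m n -` B) \<inter> set_pmf ?P)"
    by (simp add: pmf_power_def measure_Int_set_pmf)
  also have "\<dots> \<le> measure_pmf.prob ?P (Pi {..<n} A)"
  proof (rule measure_pmf.finite_measure_mono)
    show "(assemble m n -` B) \<inter> set_pmf ?P \<subseteq> Pi {..<n} A"
    proof
      fix w assume w: "w \<in> (assemble m n -` B) \<inter> set_pmf ?P"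
      show "w \<in> Pi {..<n} A"
      proof
        fix j assume j: "j \<in> {..<n}"
        have "w j \<in> X" using w j assms(2) by (auto simp: set_Pi_pmf PiE_dflt_def)
        then have "instance_of (assemble m n w) j = w j"
          using assms(1) j by (intro instance_of_assemble) auto
        then show "w j \<in> A j" using B[of "assemble m n w"] w j by force
      qed
    qed
  qed simp
  also have "\<dots> = (\<Prod>j<n. measure_pmf.prob \<mu> (A j))" by (rule measure_Pi_pmf_Pi) simp
  finally show ?thesis .
qed

lemma box_query:
  assumes "j < n"
  shows "{z \<in> box m n X L. P (z (j, i))} = box m n X (L(j := {x \<in> L j. P (x i)}))"
  using assms by (auto simp: box_def instance_of_def)

text \<open>A query to one instance splits only that instance's factor, so the product of the optimal
  values of the instances is a supersolution of the recursion for the product problem.\<close>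

lemma tree_val_box_le:
  fixes F :: "(nat \<times> nat \<Rightarrow> bool) set \<Rightarrow> real" and M :: "(nat \<Rightarrow> bool) set \<Rightarrow> real"
  assumes F: "\<And>L. (\<And>j. j < n \<Longrightarrow> L j \<subseteq> X) \<Longrightarrow> F (box m n X L) \<le> (\<Prod>j<n. M (L j))"
    and M: "\<And>L. 0 \<le> M L"
    and split: "\<And>L i. L \<subseteq> X \<Longrightarrow> i < m \<Longrightarrow> a * (M {x \<in> L. \<not> x i} + M {x \<in> L. x i}) \<le> M L"
    and a: "0 \<le> a"
    and "set_dtree D \<subseteq> {..<n} \<times> {..<m}" and "\<And>j. j < n \<Longrightarrow> L j \<subseteq> X"
  shows "tree_val F (\<lambda>k. a ^ k) D (box m n X L) \<le> (\<Prod>j<n. M (L j))"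
  using assms(5,6)
proof (induction D arbitrary: L)
  case Leaf
  then show ?case using F by simp
next
  case (Query q D0 D1)
  obtain j i where q: "q = (j, i)" by force
  with Query.prems have ji: "j < n" "i < m" by auto
  let ?L0 = "L(j := {x \<in> L j. \<not> x i})" and ?L1 = "L(j := {x \<in> L j. x i})"
  let ?P = "\<Prod>k\<in>{..<n} - {j}. M (L k)"
  have prod_upd: "(\<Prod>k<n. M ((L(j := K)) k)) = M K * ?P" for K
    using ji by (subst prod.remove[of _ j]) (auto intro!: prod.cong)
  have IH0: "tree_val F (\<lambda>k. a ^ k) D0 (box m n X ?L0) \<le> M {x \<in> L j. \<not> x i} * ?P"
    unfolding prod_upd[symmetric] using Query.prems ji by (intro Query.IH(1)) (auto split: if_splits)
  have IH1: "tree_val F (\<lambda>k. a ^ k) D1 (box m n X ?L1) \<le> M {x \<in> L j. x i} * ?P"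
    unfolding prod_upd[symmetric] using Query.prems ji by (intro Query.IH(2)) (auto split: if_splits)
  \<comment> \<open>A geometric discount turns the depth shift into one factor \<open>a\<close>,
    whichever instance is queried.\<close>
  have "tree_val F (\<lambda>k. a ^ k) (Query q D0 D1) (box m n X L)
      = a * (tree_val F (\<lambda>k. a ^ k) D0 (box m n X ?L0) + tree_val F (\<lambda>k. a ^ k) D1 (box m n X ?L1))"
    using box_query[OF ji(1), of m X L Not i] box_query[OF ji(1), of m X L "\<lambda>b. b" i]
    by (simp add: q tree_val_cmult distrib_left)
  also have "\<dots> \<le> a * (M {x \<in> L j. \<not> x i} * ?P + M {x \<in> L j. x i} * ?P)"
    using IH0 IH1 a by (intro mult_left_mono add_mono)
  also have "\<dots> = a * (M {x \<in> L j. \<not> x i} + M {x \<in> L j. x i}) * ?P" by (simp add: algebra_simps)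
  also have "\<dots> \<le> M (L j) * ?P"
    using split[of "L j" i] Query.prems ji M by (intro mult_right_mono prod_nonneg) auto
  also have "\<dots> = (\<Prod>k<n. M (L k))" using prod_upd[of "L j"] by simp
  finally show ?case .
qed

lemma dist_problem_bool:
  assumes "X \<subseteq> {..<m::nat} \<rightarrow>\<^sub>E UNIV" and "set_pmf \<mu> \<subseteq> X"
  shows "dist_problem X (UNIV :: bool set) \<mu>"
proof
  show "finite X" using assms(1) by (rule finite_subset) (auto intro: finite_PiE)
qed (use assms in auto)

lemma dist_problem_power:
  assumes "X \<subseteq> {..<m::nat} \<rightarrow>\<^sub>E UNIV" and "set_pmf \<mu> \<subseteq> X"
  shows "dist_problem (dom_power m n X) {ys :: bool list. length ys = n} (pmf_power m n \<mu>)"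
proof
  show "finite (dom_power m n X)"
    by (rule finite_subset[of _ "({..<n} \<times> {..<m}) \<rightarrow>\<^sub>E UNIV"])
       (auto simp: dom_power_def intro: finite_PiE)
  show "finite {ys :: bool list. length ys = n}"
    using finite_lists_length_eq[of "UNIV :: bool set" n] by simp
  show "{ys :: bool list. length ys = n} \<noteq> {}"
    using length_replicate[of n True] by blast
qed (rule set_pmf_power[OF assms])

text \<open>\<open>tree_val_box_le\<close> applies with \<open>M L\<close> the optimal discounted
  value of one instance started from \<open>L\<close>: it dominates both stopping at once and
  querying first.\<close>

lemma tree_val_power_le:
  fixes f :: "(nat \<Rightarrow> bool) \<Rightarrow> bool"
  assumes X: "X \<subseteq> {..<m} \<rightarrow>\<^sub>E UNIV" and \<mu>: "set_pmf \<mu> \<subseteq> X" and a: "0 \<le> a" "a \<le> 1"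
    and D: "set_dtree D \<subseteq> {..<n} \<times> {..<m}"
    and W: "\<And>E. set_dtree E \<subseteq> {..<m}
        \<Longrightarrow> tree_val (dist_problem.best X UNIV f \<mu>) (\<lambda>k. a ^ k) E X \<le> W"
  shows "tree_val (dist_problem.best (dom_power m n X) {ys. length ys = n} (fun_power n f)
    (pmf_power m n \<mu>)) (\<lambda>k. a ^ k) D (dom_power m n X) \<le> W ^ n"
proof -
  interpret single: dist_problem X UNIV f \<mu> by (rule dist_problem_bool[OF X \<mu>])
  interpret power: dist_problem "dom_power m n X" "{ys. length ys = n}" "fun_power n f" "pmf_power m n \<mu>"
    by (rule dist_problem_power[OF X \<mu>])
  define val where "val = tree_val single.best (\<lambda>k. a ^ k)"
  define M where "M L = (SUP E\<in>dtrees {..<m}. val E L)" for L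
  have bdd: "bdd_above ((\<lambda>E. val E L) ` A)" for L A
    using single.tree_val_upper[of 1 "\<lambda>k. a ^ k" _ L] a
    by (intro bdd_aboveI2[where M = "measure_pmf.prob \<mu> L"]) (auto simp: val_def power_le_one)
  have M_ge: "val E L \<le> M L" if "set_dtree E \<subseteq> {..<m}" for E L
    unfolding M_def using that by (intro cSUP_upper bdd) auto
  have best_le: "single.best L \<le> M L" for L
    using M_ge[of Leaf L] by (simp add: val_def)
  have M0: "0 \<le> M L" for L using best_le[of L] single.best_nonneg[of L] by linarith
  have ne: "dtrees {..<m} \<noteq> {}" by (auto intro: exI[of _ Leaf])
  \<comment> \<open>Querying \<open>i\<close> first is one admissible strategy. The two suprema are
    bounded one after the other; dividing by \<open>a\<close> sets the case \<open>a = 0\<close>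
    apart.\<close>
  have M_split: "a * (M {x \<in> L. \<not> x i} + M {x \<in> L. x i}) \<le> M L" if i: "i < m" for L i
  proof (cases "a = 0")
    case True
    then show ?thesis using M0 by simp
  next
    case False
    then have a0: "0 < a" using a by simp
    have sub: "val E0 {x \<in> L. \<not> x i} + val E1 {x \<in> L. x i} \<le> M L / a"
      if "set_dtree E0 \<subseteq> {..<m}" "set_dtree E1 \<subseteq> {..<m}" for E0 E1
      using M_ge[of "Query i E0 E1" L] that i a0
      by (simp add: val_def tree_val_cmult field_simps)
    have "M {x \<in> L. x i} \<le> M L / a - val E0 {x \<in> L. \<not> x i}" if "set_dtree E0 \<subseteq> {..<m}" for E0
      unfolding M_def[of "{x \<in> L. x i}"] using sub that by (intro cSUP_least ne) (auto simp: algebra_simps)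
    then have "val E0 {x \<in> L. \<not> x i} \<le> M L / a - M {x \<in> L. x i}" if "set_dtree E0 \<subseteq> {..<m}" for E0
      using that by (simp add: algebra_simps)
    then have "M {x \<in> L. \<not> x i} \<le> M L / a - M {x \<in> L. x i}"
      unfolding M_def[of "{x \<in> L. \<not> x i}"] by (intro cSUP_least ne) auto
    then show ?thesis using a0 by (simp add: field_simps)
  qed
  have leaf: "power.best (box m n X L) \<le> (\<Prod>j<n. M (L j))" for L
    unfolding power.best_def
  proof (subst Max_le_iff, goal_cases)
    case 1 then show ?case using power.finite_Out by simp
  next
    case 2 then show ?case using power.Out_ne by simp
  next
    case 3
    have "measure_pmf.prob (pmf_power m n \<mu>)
        (box m n X L \<inter> {z \<in> dom_power m n X. fun_power n f z = ys}) \<le> (\<Prod>j<n. M (L j))"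
      if ys: "length ys = n" for ys
    proof -
      \<comment> \<open>A label vector is right on a tuple only if it is right on each instance, so
        the winning event lies in a product.\<close>
      have "measure_pmf.prob (pmf_power m n \<mu>)
          (box m n X L \<inter> {z \<in> dom_power m n X. fun_power n f z = ys})
          \<le> (\<Prod>j<n. measure_pmf.prob \<mu> (L j \<inter> {x \<in> X. f x = ys ! j}))"
        by (rule prob_power_le[OF X \<mu>]) (auto simp: box_def dom_power_def fun_power_def)
      also have "\<dots> \<le> (\<Prod>j<n. M (L j))"
      proof (intro prod_mono conjI)
        fix j
        have "measure_pmf.prob \<mu> (L j \<inter> {x \<in> X. f x = ys ! j}) \<le> single.best (L j)"
          unfolding single.best_def by (rule Max_ge) auto
        then show "measure_pmf.prob \<mu> (L j \<inter> {x \<in> X. f x = ys ! j}) \<le> M (L j)"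
          using best_le[of "L j"] by linarith
      qed simp
      finally show ?thesis .
    qed
    then show ?case by auto
  qed
  have "dom_power m n X = box m n X (\<lambda>_. X)" by (auto simp: box_def dom_power_def)
  then have "tree_val power.best (\<lambda>k. a ^ k) D (dom_power m n X) \<le> (\<Prod>j<n. M X)"
    using tree_val_box_le[where M = M and F = power.best and X = X and L = "\<lambda>_. X", OF leaf M0 M_split a(1) D]
    by simp
  also have "\<dots> \<le> W ^ n"
  proof -
    have "M X \<le> W" unfolding M_def using W by (intro cSUP_least ne) (auto simp: val_def)
    then show ?thesis using M0 by (simp add: power_mono)
  qed
  finally show ?thesis .
qed

section \<open>Transfer from many instances to one\<close>

text \<open>An infimum above \<open>8 * t\<close> would yield a multiplier \<open>l\<close> bounding
  the linear score of all trees; the tree supplied by \<open>disc\<close> at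
  \<open>\<epsilon> = 8 * l\<close> violates that bound after truncation.\<close>

lemma INF_scost_le:
  fixes f :: "(nat \<Rightarrow> bool) \<Rightarrow> bool"
  assumes X: "X \<subseteq> {..<m} \<rightarrow>\<^sub>E UNIV" and \<mu>: "set_pmf \<mu> \<subseteq> X" and \<gamma>: "0 < \<gamma>" and t: "0 < t"
    and disc: "\<And>\<epsilon>. 0 < \<epsilon> \<Longrightarrow> \<exists>D. set_dtree D \<subseteq> {..<m} \<and>
      \<gamma> * exp (- \<epsilon> * t) < tree_val (dist_problem.best X UNIV f \<mu>) (\<lambda>k. exp (- \<epsilon> * real k)) D X"
  shows "(INF R\<in>{R. set_pmf R \<subseteq> dtrees {..<m} \<and> success_bar X UNIV f \<mu> R \<ge> \<gamma>}. scost_bar X UNIV f \<mu> R)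
    \<le> ennreal (8 * t)" (is "?I \<le> _")
proof (rule ccontr)
  assume "\<not> ?I \<le> ennreal (8 * t)"
  then have big: "ennreal (8 * t) < ?I" by simp
  interpret dist_problem X UNIV f \<mu> by (rule dist_problem_bool[OF X \<mu>])
  define S where "S D = tree_val best (\<lambda>_. 1) D X" for D
  define C where "C D = tree_val best real D X" for D
  have C0: "0 \<le> C D" for D unfolding C_def using best_nonneg by (intro tree_val_nonneg) auto
  have half: "measure_pmf.prob \<mu> L \<le> 2 * best L" if "L \<subseteq> X" for L
  proof -
    have "L = (L \<inter> {x \<in> X. f x = True}) \<union> (L \<inter> {x \<in> X. f x = False})" using that by auto
    then have "measure_pmf.prob \<mu> L
        = measure_pmf.prob \<mu> ((L \<inter> {x \<in> X. f x = True}) \<union> (L \<inter> {x \<in> X. f x = False}))" by simp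
    also have "\<dots> = measure_pmf.prob \<mu> (L \<inter> {x \<in> X. f x = True})
        + measure_pmf.prob \<mu> (L \<inter> {x \<in> X. f x = False})"
      by (rule measure_pmf.finite_measure_Union) auto
    also have "\<dots> \<le> best L + best L" unfolding best_def by (intro add_mono Max_ge rangeI) (rule finite_imageI, rule finite)+
    finally show ?thesis by simp
  qed
  \<comment> \<open>\<open>8 * t * \<gamma>\<close> bounds the cost numerator from below: success is
    at least \<open>\<gamma>\<close> and the conditioned cost exceeds \<open>8 * t\<close>.
    \<open>Leaf\<close> is the zero-cost point.\<close>
  have "\<exists>l>0. \<forall>D\<in>dtrees {..<m}. S D - l * C D \<le> \<gamma> - l * (8 * t * \<gamma>)"
  proof (rule lagrange_multiplier[where a = Leaf])
    show "finite (S ` dtrees {..<m})"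
      using finite_success_values by (rule finite_subset[rotated]) (auto simp: S_def)
    fix D0 D1 :: "nat dtree" and p :: real
    assume D: "D0 \<in> dtrees {..<m}" "D1 \<in> dtrees {..<m}" and p: "0 \<le> p" "p \<le> 1"
      and ge: "\<gamma> \<le> p * S D1 + (1 - p) * S D0"
    let ?R = "map_pmf (\<lambda>b. if b then D1 else D0) (bernoulli_pmf p)"
    let ?S = "success_bar X UNIV f \<mu> ?R" and ?C = "p * C D1 + (1 - p) * C D0"
    have S: "\<gamma> \<le> ?S" using ge two_point_mixture(1)[OF p] by (simp add: S_def)
    have "?I \<le> scost_bar X UNIV f \<mu> ?R" using D S by (intro INF_lower) auto
    also have "\<dots> = ennreal (?C / ?S)"
      unfolding two_point_mixture(2)[OF p, of D1 D0] C_def[symmetric]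
      using S \<gamma> C0 p by (intro divide_ennreal) auto
    finally have "ennreal (8 * t) < ennreal (?C / ?S)" by (rule less_le_trans[OF big])
    then have "8 * t < ?C / ?S" using t by (subst (asm) ennreal_less_iff) auto
    then have "8 * t * ?S < ?C"
      by (subst (asm) pos_less_divide_eq[OF less_le_trans[OF \<gamma> S]])
    moreover have "8 * t * \<gamma> \<le> 8 * t * ?S" using t by (intro mult_left_mono S) auto
    ultimately show "8 * t * \<gamma> \<le> ?C" by linarith
  qed (use C0 t \<gamma> in \<open>auto simp: C_def\<close>)
  then obtain l where l: "0 < l" "\<And>D. set_dtree D \<subseteq> {..<m} \<Longrightarrow> S D - l * C D \<le> \<gamma> - l * (8 * t * \<gamma>)"
    by auto
  \<comment> \<open>This matches the slope \<open>\<epsilon> / 8\<close> after truncation with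
    \<open>l\<close>. Both ends of the chain below then equal
    \<open>\<gamma> * (1 - \<epsilon> * t)\<close>, and its strict step is the
    contradiction.\<close>
  define \<epsilon> where "\<epsilon> = 8 * l"
  have \<epsilon>: "0 < \<epsilon>" using l by (simp add: \<epsilon>_def)
  obtain D where D: "set_dtree D \<subseteq> {..<m}"
      "\<gamma> * exp (- \<epsilon> * t) < tree_val best (\<lambda>k. exp (- \<epsilon> * real k)) D X"
    using disc[OF \<epsilon>] by blast
  define D' where "D' = trunc (nat \<lfloor>1 / \<epsilon>\<rfloor>) D"
  have "\<gamma> * (1 - \<epsilon> * t) \<le> \<gamma> * exp (- \<epsilon> * t)"
    using \<gamma> exp_ge_add_one_self[of "- \<epsilon> * t"] by (intro mult_left_mono) auto
  also have "\<dots> < tree_val best (\<lambda>k. exp (- \<epsilon> * real k)) D X" by (rule D)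
  also have "\<dots> \<le> tree_val best (\<lambda>k. 1 - \<epsilon> / 8 * real k) D' X"
    unfolding D'_def by (rule linear_ge_discounted[OF half \<epsilon>])
  also have "\<dots> = S D' - l * C D'"
    using tree_val_linear[of best 1 "\<lambda>_. 1" "- l" real D' X] by (simp add: S_def C_def \<epsilon>_def)
  also have "\<dots> \<le> \<gamma> - l * (8 * t * \<gamma>)"
    unfolding D'_def by (intro l subset_trans[OF set_dtree_trunc D(1)])
  finally show False by (simp add: \<epsilon>_def algebra_simps)
qed

text \<open>If every tree for \<open>f\<close> had discounted score at most
  \<open>\<gamma> * exp (- \<epsilon> * t)\<close>, the product bound and Jensen's inequality would
  give \<open>exp (- \<epsilon> * T) \<le> exp (- \<epsilon> * t) ^ n\<close>, hence
  \<open>real n * t \<le> T\<close>.\<close>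

lemma direct_product_distributional:
  fixes f :: "(nat \<Rightarrow> bool) \<Rightarrow> bool"
  assumes X: "X \<subseteq> {..<m} \<rightarrow>\<^sub>E UNIV" and \<mu>: "set_pmf \<mu> \<subseteq> X" and \<gamma>: "0 < \<gamma>" and n: "n \<ge> 1"
    and R: "set_pmf R \<subseteq> dtrees ({..<n} \<times> {..<m})"
    and succ: "\<gamma> ^ n \<le> success_bar (dom_power m n X) {ys. length ys = n} (fun_power n f) (pmf_power m n \<mu>) R"
  shows "ennreal (1/8 * real n) *
      (INF R\<in>{R. set_pmf R \<subseteq> dtrees {..<m} \<and> success_bar X UNIV f \<mu> R \<ge> \<gamma>}. scost_bar X UNIV f \<mu> R)
    \<le> scost_bar (dom_power m n X) {ys. length ys = n} (fun_power n f) (pmf_power m n \<mu>) R"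
    (is "_ * ?I \<le> ?sc")
proof (cases ?sc)
  case top
  then show ?thesis by simp
next
  case (real T)
  interpret single: dist_problem X UNIV f \<mu> by (rule dist_problem_bool[OF X \<mu>])
  interpret power: dist_problem "dom_power m n X" "{ys. length ys = n}" "fun_power n f" "pmf_power m n \<mu>"
    by (rule dist_problem_power[OF X \<mu>])
  \<comment> \<open>The strict inequality makes \<open>t\<close> positive even when
    \<open>T = 0\<close>, and it contradicts \<open>real n * t \<le> T\<close>.\<close>
  have le: "?I \<le> ennreal (8 * t)" if t: "T / real n < t" for t
  proof (rule INF_scost_le[OF X \<mu> \<gamma>])
    have "0 \<le> T / real n" using real(1) by simp
    then show "0 < t" using t by linarith
    fix \<epsilon> :: real assume \<epsilon>: "0 < \<epsilon>"
    show "\<exists>D. set_dtree D \<subseteq> {..<m} \<and>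
      \<gamma> * exp (- \<epsilon> * t) < tree_val single.best (\<lambda>k. exp (- \<epsilon> * real k)) D X"
    proof (rule ccontr)
      assume "\<not> ?thesis"
      then have W: "tree_val single.best (\<lambda>k. exp (- \<epsilon> * real k)) E X \<le> \<gamma> * exp (- \<epsilon> * t)"
        if "set_dtree E \<subseteq> {..<m}" for E using that by force
      have pow: "(\<lambda>k. exp (- \<epsilon> * real k)) = (\<lambda>k. exp (- \<epsilon>) ^ k)"
        by (simp add: exp_of_nat_mult[symmetric] mult.commute)
      have "success_bar (dom_power m n X) {ys. length ys = n} (fun_power n f) (pmf_power m n \<mu>) R
          * exp (- \<epsilon> * T) \<le> (\<gamma> * exp (- \<epsilon> * t)) ^ n"
      proof (rule power.discounted_ge_scost[OF real(2,1)])
        fix D assume "D \<in> set_pmf R"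
        then have D: "set_dtree D \<subseteq> {..<n} \<times> {..<m}" using R by auto
        show "tree_val power.best (\<lambda>k. exp (- \<epsilon> * real k)) D (dom_power m n X)
            \<le> (\<gamma> * exp (- \<epsilon> * t)) ^ n"
          unfolding pow using \<epsilon> W[unfolded pow] by (intro tree_val_power_le[OF X \<mu> _ _ D]) auto
      qed (use \<gamma> \<epsilon> succ in \<open>auto intro: less_le_trans[OF zero_less_power]\<close>)
      moreover have "\<gamma> ^ n * exp (- \<epsilon> * T)
          \<le> success_bar (dom_power m n X) {ys. length ys = n} (fun_power n f) (pmf_power m n \<mu>) R
            * exp (- \<epsilon> * T)"
        using succ by (intro mult_right_mono) auto
      ultimately have "\<gamma> ^ n * exp (- \<epsilon> * T) \<le> \<gamma> ^ n * exp (- \<epsilon> * t) ^ n"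
        unfolding power_mult_distrib by linarith
      then have "exp (- \<epsilon> * T) \<le> exp (- \<epsilon> * t) ^ n" using \<gamma> by simp
      also have "\<dots> = exp (- \<epsilon> * (real n * t))" by (simp add: exp_of_nat_mult[symmetric] mult_ac)
      finally have "real n * t \<le> T" using \<epsilon> by simp
      then show False using t n by (simp add: field_simps)
    qed
  qed
  \<comment> \<open>Let \<open>t\<close> decrease to \<open>T / n\<close>.\<close>
  have "?I \<le> ennreal (8 * (T / real n))"
  proof (rule ennreal_le_epsilon)
    fix e :: real assume e: "0 < e"
    have "?I \<le> ennreal (8 * (T / real n + e / 8))" using e by (intro le) simp
    also have "\<dots> = ennreal (8 * (T / real n)) + ennreal e"
      using e real(1) by (simp add: distrib_left flip: ennreal_plus)
    finally show "?I \<le> ennreal (8 * (T / real n)) + ennreal e" .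
  qed
  then have "ennreal (1/8 * real n) * ?I \<le> ennreal (1/8 * real n) * ennreal (8 * (T / real n))"
    by (rule mult_left_mono) simp
  also have "\<dots> = ennreal T" using n real(1) by (simp add: ennreal_mult[symmetric])
  finally show ?thesis using real(2) by simp
qed

theorem theorem1p7:
  "\<exists>c::real. c > 0 \<and>
     (\<forall>(m::nat) (n::nat) (X :: (nat \<Rightarrow> bool) set) (f :: (nat \<Rightarrow> bool) \<Rightarrow> bool) (\<gamma>::real).
        X \<subseteq> {..<m} \<rightarrow>\<^sub>E UNIV \<longrightarrow> 1/2 \<le> \<gamma> \<longrightarrow> \<gamma> \<le> 1 \<longrightarrow> n \<ge> 1 \<longrightarrow>
        sR (\<gamma> ^ n) ({..<n} \<times> {..<m}) (dom_power m n X) {ys. length ys = n} (fun_power n f)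
          \<ge> ennreal (c * real n) * sR \<gamma> {..<m} X UNIV f)"
\<comment> \<open>The constant is the slope of the linear score in
  \<open>linear_ge_discounted\<close>.\<close>
proof (intro exI[of _ "1/8"] conjI allI impI)
  fix m n :: nat and X :: "(nat \<Rightarrow> bool) set" and f :: "(nat \<Rightarrow> bool) \<Rightarrow> bool" and \<gamma> :: real
  assume X: "X \<subseteq> {..<m} \<rightarrow>\<^sub>E UNIV" and \<gamma>: "1/2 \<le> \<gamma>" and n: "n \<ge> 1"
  show "ennreal (1/8 * real n) * sR \<gamma> {..<m} X UNIV f
    \<le> sR (\<gamma> ^ n) ({..<n} \<times> {..<m}) (dom_power m n X) {ys. length ys = n} (fun_power n f)"
    unfolding sR_def SUP_mult_left_ennreal
  proof (intro SUP_mono, elim CollectE)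
    fix \<mu> assume \<mu>: "set_pmf \<mu> \<subseteq> X"
    \<comment> \<open>A distribution hard for \<open>f\<close> is matched by its
      \<open>n\<close>-fold product, which is hard for the tuple problem.\<close>
    show "\<exists>\<nu>\<in>{\<nu>. set_pmf \<nu> \<subseteq> dom_power m n X}.
      ennreal (1/8 * real n) *
        (INF R\<in>{R. set_pmf R \<subseteq> dtrees {..<m} \<and> success_bar X UNIV f \<mu> R \<ge> \<gamma>}. scost_bar X UNIV f \<mu> R)
      \<le> (INF R\<in>{R. set_pmf R \<subseteq> dtrees ({..<n} \<times> {..<m}) \<and>
            success_bar (dom_power m n X) {ys. length ys = n} (fun_power n f) \<nu> R \<ge> \<gamma> ^ n}.
          scost_bar (dom_power m n X) {ys. length ys = n} (fun_power n f) \<nu> R)"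
      using set_pmf_power[OF X \<mu>, of n] \<gamma>
      by (intro bexI[of _ "pmf_power m n \<mu>"] INF_greatest direct_product_distributional[OF X \<mu> _ n]) auto
  qed
qed simp

end
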